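(* For each $n$ let $P_n$ be the transition matrix of an irreducible, aperiodic, transitive, reversible Markov chain on a finite state space $X_n$, with eigenvalues $1=\beta_1>\beta_2\ge\dots\ge\beta_{|X_n|}>-1$ counted with multiplicity (the dependence on $n$ is suppressed), and let $x=x_n\in X_n$ be a starting state. Suppose that, in continuous time and started from $x$, the family exhibits total variation cutoff at $t_n$ with window $w_n$. Assume that there is a function $g:\mathbb{R}\to\mathbb{R}$ that is continuous (or bounded) such that for all $c\in\mathbb{R}$ $$\limsup_{n\to\infty}\; w_n^2\sum_{i=2}^{|X_n|} (1-\beta_i)^2\,e^{-2(t_n+cw_n)(1-\beta_i)}\le g(c).$$ Assume moreover that the total variation limit profile $\Phi_x(c)=\lim_{n\to\infty} d_x^{(n)}(t_n+cw_n)$ exists for all $c\in\mathbb{R}$. Then $\Phi_x:\mathbb{R}\to[0,1]$ is continuous.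
   Context: Continuous time walk: for a transition matrix $P=P_n$ on $X_n$ with stationary measure $\pi=\pi_n$, put $Q^t=e^{-t(I-P)}$ for $t\ge 0$, $Q_x^t(\cdot)=Q^t(x,\cdot)$, and $$d_x^{(n)}(t)=\|Q_x^t-\pi\|_{\mathrm{T.V.}}=\frac12\sum_{y\in X_n}|Q_x^t(y)-\pi(y)|.$$ Transitive: for all $u,v\in X_n$ there is a bijection $\varphi:X_n\to X_n$ with $\varphi(u)=v$ and $P(\varphi(a),\varphi(b))=P(a,b)$ for all $a,b\in X_n$. Cutoff: $t_n>0$ and $w_n>0$ are real sequences with $w_n=o(t_n)$. The family has cutoff at $t_n$ with window $w_n$ (started from $x$) if $$\lim_{c\to\infty}\lim_{n\to\infty} d_x^{(n)}(t_n-cw_n)=1\quad\text{and}\quad \lim_{c\to\infty}\lim_{n\to\infty} d_x^{(n)}(t_n+cw_n)=0.$$ For each fixed $c\in\mathbb{R}$, $t_n+cw_n>0$ for all large $n$, so limits as $n\to\infty$ make sense. *)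

theory Defs
  imports
    "HOL-Analysis.Analysis"
    "HOL-Library.Landau_Symbols"
    "HOL-Library.Countable_Set"
    "Jordan_Normal_Form.Char_Poly"
begin

text \<open>
  A matrix indexed by a finite set \<open>X\<close> is a function \<open>'a \<Rightarrow> 'a \<Rightarrow> real\<close> of which only the
  entries in \<open>X \<times> X\<close> are meaningful; every notion below is relative to \<open>X\<close>.
\<close>

definition id_kernel :: "'a \<Rightarrow> 'a \<Rightarrow> real" where
  "id_kernel a b = (if a = b then 1 else 0)"

fun kernel_power :: "'a set \<Rightarrow> ('a \<Rightarrow> 'a \<Rightarrow> real) \<Rightarrow> nat \<Rightarrow> 'a \<Rightarrow> 'a \<Rightarrow> real" where
  "kernel_power X A 0 a b = id_kernel a b"
| "kernel_power X A (Suc k) a b = (\<Sum>c\<in>X. kernel_power X A k a c * A c b)"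

definition kernel_exp :: "'a set \<Rightarrow> ('a \<Rightarrow> 'a \<Rightarrow> real) \<Rightarrow> real \<Rightarrow> 'a \<Rightarrow> 'a \<Rightarrow> real" where
  "kernel_exp X A s a b = (\<Sum>k. s ^ k / fact k * kernel_power X A k a b)"

definition transition_matrix :: "'a set \<Rightarrow> ('a \<Rightarrow> 'a \<Rightarrow> real) \<Rightarrow> bool" where
  "transition_matrix X P \<longleftrightarrow>
     (\<forall>a\<in>X. \<forall>b\<in>X. 0 \<le> P a b) \<and> (\<forall>a\<in>X. (\<Sum>b\<in>X. P a b) = 1)"

definition irreducible_chain :: "'a set \<Rightarrow> ('a \<Rightarrow> 'a \<Rightarrow> real) \<Rightarrow> bool" where
  "irreducible_chain X P \<longleftrightarrow> (\<forall>a\<in>X. \<forall>b\<in>X. \<exists>k. kernel_power X P k a b > 0)"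

definition aperiodic_chain :: "'a set \<Rightarrow> ('a \<Rightarrow> 'a \<Rightarrow> real) \<Rightarrow> bool" where
  "aperiodic_chain X P \<longleftrightarrow> (\<forall>a\<in>X. Gcd {k. k > 0 \<and> kernel_power X P k a a > 0} = 1)"

definition transitive_chain :: "'a set \<Rightarrow> ('a \<Rightarrow> 'a \<Rightarrow> real) \<Rightarrow> bool" where
  "transitive_chain X P \<longleftrightarrow>
     (\<forall>u\<in>X. \<forall>v\<in>X. \<exists>\<phi>. bij_betw \<phi> X X \<and> \<phi> u = v \<and>
        (\<forall>a\<in>X. \<forall>b\<in>X. P (\<phi> a) (\<phi> b) = P a b))"

definition stationary_distribution ::
    "'a set \<Rightarrow> ('a \<Rightarrow> 'a \<Rightarrow> real) \<Rightarrow> ('a \<Rightarrow> real) \<Rightarrow> bool" where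
  "stationary_distribution X P \<pi> \<longleftrightarrow>
     (\<forall>a\<in>X. 0 \<le> \<pi> a) \<and> (\<Sum>a\<in>X. \<pi> a) = 1 \<and>
     (\<forall>b\<in>X. (\<Sum>a\<in>X. \<pi> a * P a b) = \<pi> b)"

definition reversible_chain ::
    "'a set \<Rightarrow> ('a \<Rightarrow> 'a \<Rightarrow> real) \<Rightarrow> ('a \<Rightarrow> real) \<Rightarrow> bool" where
  "reversible_chain X P \<pi> \<longleftrightarrow> (\<forall>a\<in>X. \<forall>b\<in>X. \<pi> a * P a b = \<pi> b * P b a)"

text \<open>
  For finite \<open>X\<close>, \<open>from_nat_into X\<close> is a bijection from \<open>{..<card X}\<close> onto \<open>X\<close>; a different
  enumeration conjugates the matrix by a permutation and leaves the characteristic polynomial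
  unchanged.
\<close>

definition kernel_mat :: "'a set \<Rightarrow> ('a \<Rightarrow> 'a \<Rightarrow> real) \<Rightarrow> real Matrix.mat" where
  "kernel_mat X P = Matrix.mat (card X) (card X)
     (\<lambda>(i, j). P (from_nat_into X i) (from_nat_into X j))"

text \<open>
  \<open>\<beta> 1 \<ge> \<dots> \<ge> \<beta> (card X)\<close> are the eigenvalues of \<open>P\<close> counted with (algebraic) multiplicity.
  Values of \<open>\<beta>\<close> outside \<open>{1..card X}\<close> are irrelevant.
\<close>

definition ordered_eigenvalues ::
    "'a set \<Rightarrow> ('a \<Rightarrow> 'a \<Rightarrow> real) \<Rightarrow> (nat \<Rightarrow> real) \<Rightarrow> bool" where
  "ordered_eigenvalues X P \<beta> \<longleftrightarrow>
     char_poly (kernel_mat X P) = (\<Prod>i=1..card X. [:- \<beta> i, 1:]) \<and>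
     (\<forall>i\<in>{1..card X}. \<forall>j\<in>{1..card X}. i \<le> j \<longrightarrow> \<beta> j \<le> \<beta> i)"

definition heat_kernel :: "'a set \<Rightarrow> ('a \<Rightarrow> 'a \<Rightarrow> real) \<Rightarrow> real \<Rightarrow> 'a \<Rightarrow> 'a \<Rightarrow> real" where
  "heat_kernel X P t = kernel_exp X (\<lambda>a b. id_kernel a b - P a b) (- t)"

definition tv_distance :: "'a set \<Rightarrow> ('a \<Rightarrow> real) \<Rightarrow> ('a \<Rightarrow> real) \<Rightarrow> real" where
  "tv_distance X \<mu> \<nu> = 1 / 2 * (\<Sum>y\<in>X. \<bar>\<mu> y - \<nu> y\<bar>)"

text \<open>
  \<open>d n s\<close> is the distance to stationarity of the \<open>n\<close>-th chain at time \<open>s\<close>. The outer limits only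
  concern large \<open>c\<close>, so the inner limits are required to exist for all large \<open>c\<close>. At the finitely
  many \<open>n\<close> with \<open>t n - c * w n < 0\<close> the value of \<open>d n\<close> does not affect the limit.
\<close>

definition has_cutoff ::
    "(nat \<Rightarrow> real \<Rightarrow> real) \<Rightarrow> (nat \<Rightarrow> real) \<Rightarrow> (nat \<Rightarrow> real) \<Rightarrow> bool" where
  "has_cutoff d t w \<longleftrightarrow>
     (\<forall>n. t n > 0) \<and> (\<forall>n. w n > 0) \<and> w \<in> o(t) \<and>
     (\<exists>L. (\<forall>\<^sub>F c in at_top. (\<lambda>n. d n (t n - c * w n)) \<longlonglongrightarrow> L c) \<and> (L \<longlongrightarrow> 1) at_top) \<and>
     (\<exists>L. (\<forall>\<^sub>F c in at_top. (\<lambda>n. d n (t n + c * w n)) \<longlonglongrightarrow> L c) \<and> (L \<longlongrightarrow> 0) at_top)"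

end

theory Submission
  imports Defs "Jordan_Normal_Form.Schur_Decomposition"
begin

text \<open>
  On a finite transitive reversible chain the stationary law is uniform, so \<open>P\<close> is symmetric. By
  Cauchy--Schwarz, the \<open>L\<^sup>1\<close> norm of the time derivative of \<open>Q\<^sup>s(x, \<cdot>)\<close> is at most
  \<open>|X|\<^bsup>1/2\<^esup>\<close> times its \<open>L\<^sup>2\<close> norm, whose square is the diagonal entry of \<open>(I - P)\<^sup>2 Q\<^bsup>2s\<^esup>\<close> at \<open>x\<close>.
  By transitivity that entry is \<open>1/|X|\<close> times the trace, which is the spectral sum
  \<open>\<Sum>i. (1 - \<beta> i)\<^sup>2 exp (- 2 s (1 - \<beta> i))\<close>. This sum decreases in \<open>s\<close>, so the hypothesis at a
  single \<open>c = a\<close> makes \<open>\<Phi>\<close> Lipschitz on \<open>[a, \<infinity>)\<close> with constant \<open>(g a + 1)\<^bsup>1/2\<^esup> / 2\<close>.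
\<close>

subsection \<open>Traces of matrix powers\<close>

definition mtrace :: "real mat \<Rightarrow> real" where
  "mtrace A = (\<Sum>i<dim_row A. A $$ (i, i))"

lemma mtrace_mult_commute:
  assumes "A \<in> carrier_mat n m" "B \<in> carrier_mat m n"
  shows "mtrace (A * B) = mtrace (B * A)"
proof -
  have "mtrace (A * B) = (\<Sum>i<n. \<Sum>j<m. A $$ (i, j) * B $$ (j, i))"
    using assms by (auto simp: mtrace_def scalar_prod_def lessThan_atLeast0 intro!: sum.cong)
  also have "\<dots> = (\<Sum>j<m. \<Sum>i<n. A $$ (i, j) * B $$ (j, i))"
    by (rule sum.swap)
  also have "\<dots> = mtrace (B * A)"
    using assms by (auto simp: mtrace_def scalar_prod_def lessThan_atLeast0 mult.commute intro!: sum.cong)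
  finally show ?thesis .
qed

text \<open>Cyclicity of the trace moves \<open>P\<close> to the right end of
  \<open>P * B * Q\<close>, where it cancels against \<open>Q\<close>.\<close>

lemma mtrace_similar:
  assumes "similar_mat_wit A B P Q"
  shows "mtrace A = mtrace B"
proof -
  define n where "n = dim_row A"
  note * = similar_mat_witD[OF n_def assms]
  have "mtrace A = mtrace (P * (B * Q))"
    unfolding *(3) by (subst assoc_mult_mat[OF *(6,5,7)]) (rule refl)
  also have "\<dots> = mtrace (B * Q * P)"
    by (rule mtrace_mult_commute[OF *(6) mult_carrier_mat[OF *(5,7)]])
  also have "B * Q * P = B"
    unfolding assoc_mult_mat[OF *(5,7,6)] *(2) by (rule right_mult_one_mat[OF *(5)])
  finally show ?thesis .
qed

text \<open>A term of the entry sum over \<open>k\<close> survives only if i \<le> k \<le> j. Below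
  the diagonal no \<open>k\<close> qualifies, and on the diagonal only \<open>k = i\<close>
  does.\<close>

lemma upper_triangular_mult:
  fixes A B :: "'a :: comm_ring_1 mat"
  assumes A: "A \<in> carrier_mat n n" "upper_triangular A"
    and B: "B \<in> carrier_mat n n" "upper_triangular B"
  shows "upper_triangular (A * B)"
    and "i < n \<Longrightarrow> (A * B) $$ (i, i) = A $$ (i, i) * B $$ (i, i)"
proof -
  have entry: "(A * B) $$ (i, j) = (\<Sum>k<n. A $$ (i, k) * B $$ (k, j))" if "i < n" "j < n" for i j
    using that A B by (auto simp: scalar_prod_def lessThan_atLeast0)
  have zero: "A $$ (i, k) * B $$ (k, j) = 0" if "i < n" "k < n" "k < i \<or> j < k" for i j k
    using that A B by (auto simp: upper_triangular_def)
  show "upper_triangular (A * B)"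
  proof (rule upper_triangularI)
    fix i j assume ij: "j < i" "i < dim_row (A * B)"
    then have "(A * B) $$ (i, j) = (\<Sum>k<n. A $$ (i, k) * B $$ (k, j))"
      using A by (intro entry) auto
    also have "\<dots> = 0"
      using ij A by (intro sum.neutral ballI zero) auto
    finally show "(A * B) $$ (i, j) = 0" .
  qed
  show "(A * B) $$ (i, i) = A $$ (i, i) * B $$ (i, i)" if "i < n"
  proof -
    have "(A * B) $$ (i, i) = (\<Sum>k<n. A $$ (i, k) * B $$ (k, i))"
      using that by (intro entry) auto
    also have "\<dots> = (\<Sum>k<n. if k = i then A $$ (i, i) * B $$ (i, i) else 0)"
      by (rule sum.cong) (use that zero in \<open>auto simp: neq_iff\<close>)
    finally show ?thesis using that by simp
  qed
qed

lemma upper_triangular_pow: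
  fixes A :: "'a :: comm_ring_1 mat"
  assumes "A \<in> carrier_mat n n" "upper_triangular A"
  shows "upper_triangular (A ^\<^sub>m k) \<and> (\<forall>i<n. (A ^\<^sub>m k) $$ (i, i) = (A $$ (i, i)) ^ k)"
proof (induction k)
  case 0
  then show ?case using assms by (auto intro!: upper_triangularI)
next
  case (Suc k)
  have "A ^\<^sub>m k \<in> carrier_mat n n"
    using assms by simp
  from upper_triangular_mult[OF this _ assms] Suc show ?case
    by simp
qed

text \<open>Schur triangularisation gives a \<open>B\<close> similar to \<open>A\<close> with
  \<open>es\<close> on its diagonal. The same \<open>P\<close> and \<open>Q\<close> conjugate
  \<open>1 - A\<close> to \<open>1 - B\<close>, whose powers are triangular with the powers of
  \<open>1 - e\<close> on the diagonal, and similarity preserves the trace.\<close>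

lemma mtrace_pow_one_minus:
  assumes A: "A \<in> carrier_mat n n"
    and cp: "char_poly A = (\<Prod>e\<leftarrow>es. [:- e, 1:])"
  shows "mtrace ((1\<^sub>m n - A) ^\<^sub>m k) = (\<Sum>e\<leftarrow>es. (1 - e) ^ k)"
proof -
  obtain B P Q where "schur_decomposition A es = (B, P, Q)"
    by (cases "schur_decomposition A es")
  from schur_decomposition[OF A cp this]
  have wit: "similar_mat_wit A B P Q" and ut: "upper_triangular B" and diag: "diag_mat B = es"
    by auto
  from similar_mat_witD2[OF A wit]
  have c: "B \<in> carrier_mat n n" "P \<in> carrier_mat n n" "Q \<in> carrier_mat n n"
    and PQ: "P * Q = 1\<^sub>m n" "Q * P = 1\<^sub>m n" "A = P * B * Q" by auto
  have "P * (1\<^sub>m n - B) = P - P * B"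
    using c by (subst mult_minus_distrib_mat[of _ n n _ n]) auto
  moreover have "(P - P * B) * Q = 1\<^sub>m n - A"
    unfolding PQ(3) by (subst minus_mult_distrib_mat[of _ n n _ _ n]) (use c PQ(1) in auto)
  ultimately have "1\<^sub>m n - A = P * (1\<^sub>m n - B) * Q"
    by simp
  then have "similar_mat_wit (1\<^sub>m n - A) (1\<^sub>m n - B) P Q"
    by (intro similar_mat_witI[OF PQ(1,2)]) (use c A in auto)
  then have "mtrace ((1\<^sub>m n - A) ^\<^sub>m k) = mtrace ((1\<^sub>m n - B) ^\<^sub>m k)"
    by (intro mtrace_similar similar_mat_wit_pow)
  also have "\<dots> = (\<Sum>i<n. (1 - B $$ (i, i)) ^ k)"
  proof -
    have "upper_triangular (1\<^sub>m n - B)" "1\<^sub>m n - B \<in> carrier_mat n n"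
      using ut c by (auto intro!: upper_triangularI simp: upper_triangular_def)
    from upper_triangular_pow[OF this(2,1), of k] this c show ?thesis
      by (auto simp: mtrace_def intro!: sum.cong)
  qed
  also have "\<dots> = (\<Sum>e\<leftarrow>es. (1 - e) ^ k)"
    using c diag[symmetric] by (simp add: diag_mat_def comp_def interv_sum_list_conv_sum_set_nat lessThan_atLeast0)
  finally show ?thesis .
qed

section \<open>Kernels on a finite set as matrices\<close>

lemma kernel_mat_pow:
  assumes "finite X"
  shows "i < card X \<Longrightarrow> j < card X \<Longrightarrow>
    (kernel_mat X A ^\<^sub>m k) $$ (i, j) = kernel_power X A k (from_nat_into X i) (from_nat_into X j)"
proof (induction k arbitrary: j)
  case 0
  have inj: "inj_on (from_nat_into X) {..<card X}"
    using bij_betw_from_nat_into_finite[OF assms] by (simp add: bij_betw_def)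
  show ?case using 0 inj by (auto simp: id_kernel_def kernel_mat_def inj_on_def)
next
  case (Suc k)
  have [simp]: "kernel_mat X A \<in> carrier_mat (card X) (card X)"
    "dim_row (kernel_mat X A) = card X" "dim_col (kernel_mat X A) = card X"
    "dim_row (kernel_mat X A ^\<^sub>m k) = card X" "dim_col (kernel_mat X A ^\<^sub>m k) = card X"
    by (auto simp: kernel_mat_def)
  have "(kernel_mat X A ^\<^sub>m Suc k) $$ (i, j) =
    (\<Sum>l<card X. (kernel_mat X A ^\<^sub>m k) $$ (i, l) * kernel_mat X A $$ (l, j))"
    using Suc.prems by (auto simp: scalar_prod_def lessThan_atLeast0)
  also have "\<dots> = (\<Sum>l<card X. kernel_power X A k (from_nat_into X i) (from_nat_into X l)
      * A (from_nat_into X l) (from_nat_into X j))"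
    using Suc by (intro sum.cong) (auto simp: kernel_mat_def)
  also have "\<dots> = (\<Sum>c\<in>X. kernel_power X A k (from_nat_into X i) c * A c (from_nat_into X j))"
    by (rule sum.reindex_bij_betw[OF bij_betw_from_nat_into_finite[OF assms]])
  finally show ?case by simp
qed

text \<open>This is the only entry point of the eigenvalues: every later spectral sum comes from the
  traces of the powers of I - P.\<close>

lemma sum_kernel_power_diag:
  assumes "finite X" and "ordered_eigenvalues X P \<beta>"
  shows "(\<Sum>a\<in>X. kernel_power X (\<lambda>a b. id_kernel a b - P a b) k a a) = (\<Sum>i=1..card X. (1 - \<beta> i) ^ k)"
proof -
  let ?M = "\<lambda>a b. id_kernel a b - P a b"
  have inj: "inj_on (from_nat_into X) {..<card X}"
    using bij_betw_from_nat_into_finite[OF assms(1)] by (simp add: bij_betw_def)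
  have M: "kernel_mat X ?M = 1\<^sub>m (card X) - kernel_mat X P"
    using inj by (auto simp: kernel_mat_def id_kernel_def inj_on_def)
  \<comment> \<open>Eigenvalues are indexed from 1 but lists from 0; \<open>l\<close> and
    \<open>l'\<close> convert the product and the sum to the list form of
    \<open>mtrace_pow_one_minus\<close>.\<close>
  have l: "prod f {Suc 0..n} = prod_list (map (\<lambda>i. f (Suc i)) [0..<n])" for f :: "nat \<Rightarrow> real poly" and n
    by (induction n) (auto simp: mult.commute)
  have l': "sum f {Suc 0..n} = sum_list (map (\<lambda>i. f (Suc i)) [0..<n])" for f :: "nat \<Rightarrow> real" and n
    by (induction n) (auto simp: add.commute)
  have "(\<Sum>a\<in>X. kernel_power X ?M k a a) =
      (\<Sum>i<card X. kernel_power X ?M k (from_nat_into X i) (from_nat_into X i))"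
    by (rule sum.reindex_bij_betw[OF bij_betw_from_nat_into_finite[OF assms(1)], symmetric])
  also have "\<dots> = mtrace (kernel_mat X ?M ^\<^sub>m k)"
  proof -
    have "kernel_mat X ?M ^\<^sub>m k \<in> carrier_mat (card X) (card X)"
      by (auto simp: kernel_mat_def)
    then show ?thesis
      using kernel_mat_pow[OF assms(1)] by (auto simp: mtrace_def)
  qed
  also have "\<dots> = (\<Sum>i\<leftarrow>map (\<lambda>i. \<beta> (Suc i)) [0..<card X]. (1 - i) ^ k)"
    unfolding M using assms(2)
    by (intro mtrace_pow_one_minus) (auto simp: kernel_mat_def ordered_eigenvalues_def l comp_def)
  also have "\<dots> = (\<Sum>i=1..card X. (1 - \<beta> i) ^ k)"
    by (simp add: l' comp_def)
  finally show ?thesis .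
qed

subsection \<open>Kernel powers and the heat kernel\<close>

lemma sum_mult_id_kernel:
  assumes "finite X" "b \<in> X"
  shows "(\<Sum>c\<in>X. f c * id_kernel c b) = f b" and "(\<Sum>c\<in>X. id_kernel b c * f c) = f b"
proof -
  have "(\<Sum>c\<in>X. f c * id_kernel c b) = (\<Sum>c\<in>X. if c = b then f c else 0)"
    by (rule sum.cong) (auto simp: id_kernel_def)
  then show "(\<Sum>c\<in>X. f c * id_kernel c b) = f b"
    using assms by simp
  have "(\<Sum>c\<in>X. id_kernel b c * f c) = (\<Sum>c\<in>X. if b = c then f c else 0)"
    by (rule sum.cong) (auto simp: id_kernel_def)
  then show "(\<Sum>c\<in>X. id_kernel b c * f c) = f b"
    using assms by simp
qed

lemma kernel_power_add:
  assumes "finite X" "a \<in> X" "b \<in> X"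
  shows "kernel_power X A (j + k) a b = (\<Sum>c\<in>X. kernel_power X A j a c * kernel_power X A k c b)"
  using assms(3)
proof (induction k arbitrary: b)
  case 0
  then show ?case using assms(1) by (simp add: sum_mult_id_kernel)
next
  case (Suc k)
  have "kernel_power X A (j + Suc k) a b =
      (\<Sum>c\<in>X. (\<Sum>e\<in>X. kernel_power X A j a e * kernel_power X A k e c) * A c b)"
    using Suc by simp
  also have "\<dots> = (\<Sum>e\<in>X. \<Sum>c\<in>X. kernel_power X A j a e * (kernel_power X A k e c * A c b))"
    unfolding sum_distrib_right by (subst sum.swap) (simp add: mult.assoc)
  also have "\<dots> = (\<Sum>e\<in>X. kernel_power X A j a e * kernel_power X A (Suc k) e b)"
    by (simp add: sum_distrib_left)
  finally show ?case .
qed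

lemma kernel_power_Suc_left:
  assumes "finite X" "a \<in> X" "b \<in> X"
  shows "kernel_power X A (Suc k) a b = (\<Sum>c\<in>X. A a c * kernel_power X A k c b)"
proof -
  have "kernel_power X A 1 a c = A a c" if "c \<in> X" for c
    using assms by (simp add: sum_mult_id_kernel)
  then show ?thesis using kernel_power_add[OF assms, of A 1 k] by simp
qed

text \<open>Detailed balance carries the weight along a path one step at a time, from
  \<open>a\<close> through \<open>c\<close> to \<open>b\<close>. With the constant weight 1 this
  says that powers of a symmetric kernel are symmetric.\<close>

lemma reversible_kernel_power:
  assumes "finite X" "a \<in> X" "b \<in> X" and rev: "\<forall>a\<in>X. \<forall>b\<in>X. \<pi> a * A a b = \<pi> b * A b a"
  shows "\<pi> a * kernel_power X A k a b = \<pi> b * kernel_power X A k b a"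
  using assms(2,3)
proof (induction k arbitrary: a b)
  case 0
  then show ?case by (simp add: id_kernel_def)
next
  case (Suc k)
  have "\<pi> a * kernel_power X A (Suc k) a b = (\<Sum>c\<in>X. \<pi> a * kernel_power X A k a c * A c b)"
    by (simp add: sum_distrib_left mult.assoc)
  also have "\<dots> = (\<Sum>c\<in>X. \<pi> b * (A b c * kernel_power X A k c a))"
  proof (rule sum.cong)
    fix c assume "c \<in> X"
    with Suc rev have *: "\<pi> a * kernel_power X A k a c = \<pi> c * kernel_power X A k c a"
      "\<pi> c * A c b = \<pi> b * A b c" by blast+
    have "\<pi> a * kernel_power X A k a c * A c b = \<pi> c * A c b * kernel_power X A k c a"
      unfolding *(1) by simp
    then show "\<pi> a * kernel_power X A k a c * A c b = \<pi> b * (A b c * kernel_power X A k c a)"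
      unfolding *(2) by simp
  qed simp
  also have "\<dots> = \<pi> b * kernel_power X A (Suc k) b a"
    using Suc.prems assms(1) by (simp only: kernel_power_Suc_left sum_distrib_left)
  finally show ?case .
qed

lemma kernel_power_nonneg:
  assumes "\<forall>a\<in>X. \<forall>b\<in>X. 0 \<le> A a b" "b \<in> X"
  shows "0 \<le> kernel_power X A k a b"
  using assms(2)
  by (induction k arbitrary: b) (use assms(1) in \<open>auto simp: id_kernel_def intro!: sum_nonneg\<close>)

text \<open>An automorphism of the kernel merely relabels the intermediate state in each matrix
  product.\<close>

lemma kernel_power_bij:
  assumes \<phi>: "bij_betw \<phi> X X" and A: "\<forall>a\<in>X. \<forall>b\<in>X. A (\<phi> a) (\<phi> b) = A a b"
    and "a \<in> X" "b \<in> X"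
  shows "kernel_power X A k (\<phi> a) (\<phi> b) = kernel_power X A k a b"
  using assms(4)
proof (induction k arbitrary: b)
  case 0
  then show ?case using bij_betw_imp_inj_on[OF \<phi>] assms(3) by (auto simp: id_kernel_def inj_on_def)
next
  case (Suc k)
  have "kernel_power X A (Suc k) (\<phi> a) (\<phi> b) = (\<Sum>c\<in>X. kernel_power X A k (\<phi> a) (\<phi> c) * A (\<phi> c) (\<phi> b))"
    unfolding kernel_power.simps by (rule sum.reindex_bij_betw[OF \<phi>, symmetric])
  also have "\<dots> = kernel_power X A (Suc k) a b"
    using Suc A by (auto intro!: sum.cong)
  finally show ?case .
qed

text \<open>The sum of all absolute entries is a crude bound for every absolute row sum; its
  geometric growth is all that convergence of the exponential series requires.\<close>

lemma kernel_power_bound: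
  assumes "finite X" "a \<in> X"
  shows "(\<Sum>b\<in>X. \<bar>kernel_power X A k a b\<bar>) \<le> (\<Sum>c\<in>X. \<Sum>b\<in>X. \<bar>A c b\<bar>) ^ k"
proof (induction k)
  case 0
  have "\<bar>id_kernel a b\<bar> = id_kernel a b * 1" for b :: 'a
    by (simp add: id_kernel_def)
  then show ?case using assms sum_mult_id_kernel(2)[of X a "\<lambda>_. 1"] by simp
next
  case (Suc k)
  let ?C = "\<Sum>c\<in>X. \<Sum>b\<in>X. \<bar>A c b\<bar>"
  have "(\<Sum>b\<in>X. \<bar>kernel_power X A (Suc k) a b\<bar>) \<le> (\<Sum>b\<in>X. \<Sum>c\<in>X. \<bar>kernel_power X A k a c\<bar> * \<bar>A c b\<bar>)"
    unfolding kernel_power.simps abs_mult[symmetric] by (rule sum_mono, rule sum_abs)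
  also have "\<dots> = (\<Sum>c\<in>X. \<bar>kernel_power X A k a c\<bar> * (\<Sum>b\<in>X. \<bar>A c b\<bar>))"
    by (subst sum.swap) (simp add: sum_distrib_left)
  also have "\<dots> \<le> (\<Sum>c\<in>X. \<bar>kernel_power X A k a c\<bar> * ?C)"
  proof (rule sum_mono, rule mult_left_mono)
    fix c assume "c \<in> X"
    then show "(\<Sum>b\<in>X. \<bar>A c b\<bar>) \<le> ?C"
      using assms(1) by (intro member_le_sum[of c X "\<lambda>c. \<Sum>b\<in>X. \<bar>A c b\<bar>"]) (auto simp: sum_nonneg)
  qed simp
  also have "\<dots> \<le> ?C ^ k * ?C"
    unfolding sum_distrib_right[symmetric] by (rule mult_right_mono[OF Suc]) (simp add: sum_nonneg)
  finally show ?case by (simp add: mult.commute)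
qed

text \<open>The shift \<open>r\<close> lets one majorant serve the exponential itself
  (\<open>r = 0\<close>), its derivative (\<open>r = 1\<close>) and the squared norm of the
  derivative (\<open>r = 2\<close>).\<close>

lemma summable_kernel_power:
  assumes "finite X" "a \<in> X" "b \<in> X"
  shows "summable (\<lambda>k. norm (s ^ k / fact k * kernel_power X A (k + r) a b))"
proof -
  define C where "C = (\<Sum>c\<in>X. \<Sum>b\<in>X. \<bar>A c b\<bar>)"
  have "0 \<le> C" by (simp add: C_def sum_nonneg)
  have bound: "\<bar>kernel_power X A k a b\<bar> \<le> C ^ k" for k
  proof -
    have "\<bar>kernel_power X A k a b\<bar> \<le> (\<Sum>b\<in>X. \<bar>kernel_power X A k a b\<bar>)"
      using assms by (intro member_le_sum) auto
    also have "\<dots> \<le> C ^ k"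
      unfolding C_def by (rule kernel_power_bound) fact+
    finally show ?thesis .
  qed
  have "summable (\<lambda>k. inverse (fact k) * (\<bar>s\<bar> * C) ^ k * C ^ r)"
    by (intro summable_mult2 summable_exp)
  then show ?thesis
  proof (rule summable_comparison_test[rotated], intro exI allI impI)
    fix k
    have "norm (norm (s ^ k / fact k * kernel_power X A (k + r) a b)) =
        \<bar>s\<bar> ^ k / fact k * \<bar>kernel_power X A (k + r) a b\<bar>"
      by (simp add: abs_mult power_abs)
    also have "\<dots> \<le> \<bar>s\<bar> ^ k / fact k * C ^ (k + r)"
      by (intro mult_left_mono bound) auto
    also have "\<dots> = inverse (fact k) * (\<bar>s\<bar> * C) ^ k * C ^ r"
      by (simp add: field_simps power_add power_mult_distrib)
    finally show "norm (norm (s ^ k / fact k * kernel_power X A (k + r) a b))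
      \<le> inverse (fact k) * (\<bar>s\<bar> * C) ^ k * C ^ r" .
  qed
qed

section \<open>The time derivative and its norm\<close>

lemma has_real_derivative_kernel_exp:
  assumes "finite X" "a \<in> X" "b \<in> X"
  shows "((\<lambda>s. kernel_exp X A s a b) has_real_derivative
    (\<Sum>k. s ^ k / fact k * kernel_power X A (Suc k) a b)) (at s)"
proof -
  let ?c = "\<lambda>k. kernel_power X A k a b / fact k"
  have "summable (\<lambda>k. ?c k * y ^ k)" for y
    using summable_norm_cancel[OF summable_kernel_power[OF assms, of y A 0]] by (simp add: mult_ac)
  from termdiffs_strong_converges_everywhere[of ?c, OF this]
  have "((\<lambda>s. \<Sum>k. ?c k * s ^ k) has_real_derivative (\<Sum>k. diffs ?c k * s ^ k)) (at s)" .
  \<comment> \<open>Termwise differentiation shifts the index; the factor \<open>k + 1\<close>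
    cancels against the factorial of \<open>k + 1\<close>.\<close>
  moreover have "diffs ?c k * s ^ k = s ^ k / fact k * kernel_power X A (Suc k) a b" for k
    by (simp add: diffs_def field_simps del: kernel_power.simps of_nat_Suc)
  ultimately show ?thesis
    unfolding kernel_exp_def by (simp add: mult_ac del: kernel_power.simps)
qed

text \<open>
  By symmetry of \<open>A\<close>, the squared norm of the row of \<open>A e\<^bsup>sA\<^esup>\<close> at \<open>a\<close> is the diagonal entry of
  \<open>A\<^sup>2 e\<^bsup>2sA\<^esup>\<close>.
\<close>
lemma sum_kernel_exp_derivative_square:
  assumes X: "finite X" "a \<in> X" and sym: "\<forall>a\<in>X. \<forall>b\<in>X. A a b = A b a"
  shows "(\<lambda>k. (2 * s) ^ k / fact k * kernel_power X A (k + 2) a a) sums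
    (\<Sum>b\<in>X. (\<Sum>k. s ^ k / fact k * kernel_power X A (Suc k) a b)\<^sup>2)"
proof -
  let ?u = "\<lambda>b k. s ^ k / fact k * kernel_power X A (Suc k) a b"
  have "(\<lambda>m. \<Sum>b\<in>X. \<Sum>i\<le>m. ?u b i * ?u b (m - i)) sums (\<Sum>b\<in>X. (\<Sum>k. ?u b k) * (\<Sum>k. ?u b k))"
    using summable_kernel_power[OF X, of _ s A 1]
    by (intro sums_sum Cauchy_product_sums) (auto simp del: kernel_power.simps)
  moreover have "(\<Sum>b\<in>X. \<Sum>i\<le>m. ?u b i * ?u b (m - i)) =
      (2 * s) ^ m / fact m * kernel_power X A (m + 2) a a" for m
  proof -
    have "(\<Sum>b\<in>X. \<Sum>i\<le>m. ?u b i * ?u b (m - i)) = (\<Sum>i\<le>m. \<Sum>b\<in>X. ?u b i * ?u b (m - i))"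
      by (rule sum.swap)
    also have "\<dots> = (\<Sum>i\<le>m. s ^ m / fact m * kernel_power X A (m + 2) a a * real (m choose i))"
    proof (rule sum.cong)
      fix i assume "i \<in> {..m}"
      then have i: "i \<le> m" by simp
      \<comment> \<open>Reversing the second factor turns the sum over \<open>b\<close> of products
        of row entries into a matrix product, hence a single diagonal entry.\<close>
      have sym': "kernel_power X A k a b = kernel_power X A k b a" if "b \<in> X" for b k
        using reversible_kernel_power[of X a b "\<lambda>_. 1" A k] X sym that by simp
      have "(\<Sum>b\<in>X. ?u b i * ?u b (m - i)) = s ^ i * s ^ (m - i) / (fact i * fact (m - i)) *
          (\<Sum>b\<in>X. kernel_power X A (Suc i) a b * kernel_power X A (Suc (m - i)) b a)"
        unfolding sum_distrib_left
        by (rule sum.cong) (use sym'[of _ "Suc (m - i)"] in \<open>auto simp del: kernel_power.simps\<close>)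
      also have "\<dots> = s ^ i * s ^ (m - i) / (fact i * fact (m - i)) * kernel_power X A (Suc i + Suc (m - i)) a a"
        using X by (simp only: kernel_power_add)
      also have "Suc i + Suc (m - i) = m + 2" using i by simp
      also have "s ^ i * s ^ (m - i) = s ^ m" using i by (simp flip: power_add)
      also have "s ^ m / (fact i * fact (m - i)) = s ^ m / fact m * real (m choose i)"
        using i by (simp add: binomial_fact)
      finally show "(\<Sum>b\<in>X. ?u b i * ?u b (m - i)) =
          s ^ m / fact m * kernel_power X A (m + 2) a a * real (m choose i)"
        by (simp only: mult_ac)
    qed simp
    also have "\<dots> = s ^ m / fact m * kernel_power X A (m + 2) a a * real (\<Sum>i\<le>m. m choose i)"
      by (simp only: sum_distrib_left of_nat_sum)
    \<comment> \<open>The binomial coefficients of row \<open>m\<close> add up to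
      \<open>2 ^ m\<close>, which doubles the time.\<close>
    also have "\<dots> = (2 * s) ^ m / fact m * kernel_power X A (m + 2) a a"
      by (simp add: choose_row_sum power_mult_distrib del: kernel_power.simps)
    finally show ?thesis .
  qed
  ultimately show ?thesis by (simp only: power2_eq_square)
qed

section \<open>The heat kernel as a probability kernel\<close>

lemma kernel_power_id_minus:
  assumes "finite X" "b \<in> X"
  shows "kernel_power X (\<lambda>a b. id_kernel a b - P a b) m a b =
    (\<Sum>i\<le>m. real (m choose i) * (-1) ^ i * kernel_power X P i a b)"
  using assms(2)
proof (induction m arbitrary: b)
  case 0
  then show ?case by simp
next
  case (Suc m)
  let ?M = "\<lambda>a b. id_kernel a b - P a b"
  let ?f = "\<lambda>i. (-1) ^ i * kernel_power X P i a b"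
  \<comment> \<open>This is applied with \<open>u i = m choose Suc i\<close> and
    \<open>v i = m choose i\<close>, so the merged coefficient is given by Pascal's rule. The inner
    minus is the sign gained with each further factor \<open>P\<close>.\<close>
  have regroup: "z + (\<Sum>i\<le>m. u i * h i) - (\<Sum>i\<le>m. - (v i * h i)) = z + (\<Sum>i\<le>m. (v i + u i) * h i)"
    for z :: real and u v h
    by (simp add: sum_negf sum.distrib distrib_right)
  have "kernel_power X ?M (Suc m) a b =
      kernel_power X ?M m a b - (\<Sum>c\<in>X. kernel_power X ?M m a c * P c b)"
    using assms(1) Suc.prems
    by (simp add: right_diff_distrib sum_subtractf sum_mult_id_kernel)
  also have "(\<Sum>c\<in>X. kernel_power X ?M m a c * P c b) =
      (\<Sum>c\<in>X. \<Sum>i\<le>m. real (m choose i) * (-1) ^ i * kernel_power X P i a c * P c b)"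
    by (simp add: Suc.IH sum_distrib_right)
  also have "\<dots> = (\<Sum>i\<le>m. - (real (m choose i) * ?f (Suc i)))"
    by (subst sum.swap) (simp add: sum_distrib_left mult.assoc sum_negf)
  \<comment> \<open>The range may be extended to \<open>Suc m\<close> because
    \<open>m choose Suc m\<close> is 0; the index can then be shifted.\<close>
  also have "kernel_power X ?M m a b = (\<Sum>i\<le>Suc m. real (m choose i) * ?f i)"
    using Suc by (simp add: mult.assoc)
  also have "\<dots> = ?f 0 + (\<Sum>i\<le>m. real (m choose Suc i) * ?f (Suc i))"
    by (subst sum.atMost_Suc_shift) simp
  also have "\<dots> - (\<Sum>i\<le>m. - (real (m choose i) * ?f (Suc i))) =
      ?f 0 + (\<Sum>i\<le>m. real (Suc m choose Suc i) * ?f (Suc i))"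
    unfolding regroup binomial_Suc_Suc of_nat_add ..
  also have "\<dots> = (\<Sum>i\<le>Suc m. real (Suc m choose i) * ?f i)"
    by (subst sum.atMost_Suc_shift[of _ m]) simp
  finally show ?case by (simp only: mult.assoc)
qed

text \<open>The identity commutes with \<open>P\<close>, so the exponential factors: the Cauchy
  product of the series for \<open>exp (- s)\<close> and for the exponential of \<open>sP\<close>
  recovers the binomial expansion of the powers of I - P. In this form positivity for nonnegative
  times is visible.\<close>

lemma heat_kernel_eq:
  assumes "finite X" "a \<in> X" "b \<in> X"
  shows "heat_kernel X P s a b = exp (- s) * kernel_exp X P s a b"
proof -
  let ?M = "\<lambda>a b. id_kernel a b - P a b"
  let ?u = "\<lambda>k. s ^ k / fact k * kernel_power X P k a b"
  let ?v = "\<lambda>k. (- s) ^ k / fact k"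
  have "(\<Sum>i\<le>m. ?u i * ?v (m - i)) = (- s) ^ m / fact m * kernel_power X ?M m a b" for m
  proof -
    have "?u i * ?v (m - i) =
        (- s) ^ m / fact m * (real (m choose i) * (-1) ^ i * kernel_power X P i a b)"
      if "i \<le> m" for i
    proof -
      have "(- s) ^ m = (- s) ^ i * (- s) ^ (m - i)" using that by (simp flip: power_add)
      also have "(- s) ^ i = (-1) ^ i * s ^ i" by (rule power_minus)
      finally have "(- s) ^ m * (-1) ^ i = s ^ i * (- s) ^ (m - i)"
        by (simp add: mult_ac flip: power_mult_distrib)
      then show ?thesis using that by (simp add: binomial_fact mult_ac)
    qed
    then show ?thesis
      using assms by (simp add: kernel_power_id_minus sum_distrib_left)
  qed
  moreover have "(\<lambda>m. \<Sum>i\<le>m. ?u i * ?v (m - i)) sums ((\<Sum>k. ?u k) * (\<Sum>k. ?v k))"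
    using summable_kernel_power[OF assms, of s P 0] summable_norm_exp[of "- s"]
    by (intro Cauchy_product_sums) (auto simp: divide_inverse mult.commute)
  moreover have "(\<Sum>k. ?v k) = exp (- s)"
    by (simp add: exp_def divide_inverse mult.commute)
  ultimately show ?thesis
    by (simp add: heat_kernel_def kernel_exp_def sums_iff mult.commute)
qed

lemma heat_kernel_nonneg:
  assumes "finite X" "a \<in> X" "b \<in> X" "transition_matrix X P" "0 \<le> s"
  shows "0 \<le> heat_kernel X P s a b"
proof -
  have "0 \<le> kernel_exp X P s a b"
    unfolding kernel_exp_def using summable_norm_cancel[OF summable_kernel_power[OF assms(1-3), of s P 0]] assms
    by (intro suminf_nonneg mult_nonneg_nonneg kernel_power_nonneg) (auto simp: transition_matrix_def)
  then show ?thesis using assms by (simp add: heat_kernel_eq)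
qed

text \<open>The rows of I - P sum to 0, so only the term \<open>k = 0\<close> of the series
  contributes to the total mass.\<close>

lemma sum_heat_kernel:
  assumes "finite X" "a \<in> X" "transition_matrix X P"
  shows "(\<Sum>b\<in>X. heat_kernel X P s a b) = 1"
proof -
  let ?M = "\<lambda>a b. id_kernel a b - P a b"
  have row: "(\<Sum>b\<in>X. ?M c b) = 0" if "c \<in> X" for c
    using assms that by (simp add: sum_subtractf transition_matrix_def id_kernel_def)
  have pow: "(\<Sum>b\<in>X. kernel_power X ?M k a b) = (if k = 0 then 1 else 0)" for k
  proof (cases k)
    case 0
    then show ?thesis using assms by (simp add: id_kernel_def)
  next
    case (Suc j)
    have "(\<Sum>b\<in>X. kernel_power X ?M k a b) = (\<Sum>c\<in>X. kernel_power X ?M j a c * (\<Sum>b\<in>X. ?M c b))"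
      unfolding Suc kernel_power.simps sum_distrib_left by (rule sum.swap)
    then show ?thesis using row Suc by simp
  qed
  have "(\<lambda>k. \<Sum>b\<in>X. (- s) ^ k / fact k * kernel_power X ?M k a b) sums (\<Sum>b\<in>X. heat_kernel X P s a b)"
    unfolding heat_kernel_def kernel_exp_def
    using summable_norm_cancel[OF summable_kernel_power[OF assms(1,2), of _ "- s" ?M 0]]
    by (intro sums_sum summable_sums) simp
  moreover have "(\<lambda>k. \<Sum>b\<in>X. (- s) ^ k / fact k * kernel_power X ?M k a b) =
      (\<lambda>k. if k = 0 then 1 else 0)"
    by (simp only: pow flip: sum_distrib_left) (auto intro!: ext)
  ultimately have "(\<lambda>k. if k = 0 then 1 else 0) sums (\<Sum>b\<in>X. heat_kernel X P s a b)"
    by simp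
  from sums_unique2[OF sums_single[of 0 "\<lambda>_. 1"] this] show ?thesis by simp
qed

lemma tv_distance_heat_kernel_le_1:
  assumes "finite X" "a \<in> X" "transition_matrix X P" "stationary_distribution X P \<pi>" "0 \<le> s"
  shows "tv_distance X (heat_kernel X P s a) \<pi> \<le> 1"
proof -
  have "(\<Sum>y\<in>X. \<bar>heat_kernel X P s a y - \<pi> y\<bar>) \<le> (\<Sum>y\<in>X. heat_kernel X P s a y + \<pi> y)"
  proof (rule sum_mono)
    fix y assume "y \<in> X"
    with assms heat_kernel_nonneg[OF assms(1,2) _ assms(3,5), of y]
    show "\<bar>heat_kernel X P s a y - \<pi> y\<bar> \<le> heat_kernel X P s a y + \<pi> y"
      by (simp add: stationary_distribution_def abs_le_iff)
  qed
  also have "\<dots> = 2"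
    using assms by (simp add: sum.distrib sum_heat_kernel stationary_distribution_def)
  finally show ?thesis by (simp add: tv_distance_def)
qed

subsection \<open>Transitive reversible chains\<close>

text \<open>Detailed balance along a path of positive probability fixes the ratio of the weights at
  its ends. The ratio is kept as a cross product, so vanishing weights need no separate treatment;
  summing over \<open>b\<close> then normalises.\<close>

lemma reversible_distribution_unique:
  assumes X: "finite X" and irr: "irreducible_chain X P"
    and rev: "reversible_chain X P \<pi>" "reversible_chain X P \<rho>"
    and sum: "(\<Sum>a\<in>X. \<pi> a) = 1" "(\<Sum>a\<in>X. \<rho> a) = 1" and a: "a \<in> X"
  shows "\<pi> a = \<rho> a"
proof -
  have "\<pi> b * \<rho> a = \<pi> a * \<rho> b" if b: "b \<in> X" for b
  proof -
    obtain k where k: "kernel_power X P k a b > 0"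
      using irr a b by (auto simp: irreducible_chain_def)
    have "\<pi> a * kernel_power X P k a b = \<pi> b * kernel_power X P k b a"
      "\<rho> a * kernel_power X P k a b = \<rho> b * kernel_power X P k b a"
      using rev a b X by (auto intro!: reversible_kernel_power simp: reversible_chain_def)
    note kb = this
    have "(\<pi> b * \<rho> a) * kernel_power X P k a b = \<pi> b * (\<rho> a * kernel_power X P k a b)"
      by (rule mult.assoc)
    also have "\<dots> = \<rho> b * (\<pi> b * kernel_power X P k b a)"
      unfolding kb(2) by (rule mult.left_commute)
    also have "\<dots> = (\<pi> a * \<rho> b) * kernel_power X P k a b"
      unfolding kb(1)[symmetric] by simp
    finally show ?thesis using k by simp
  qed
  then have "(\<Sum>b\<in>X. \<pi> b) * \<rho> a = \<pi> a * (\<Sum>b\<in>X. \<rho> b)"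
    by (simp add: sum_distrib_left sum_distrib_right)
  then show ?thesis using sum by simp
qed

text \<open>Composing \<pi> with an automorphism gives another reversible distribution, which is
  \<pi> by uniqueness. Transitivity makes \<pi> constant, and the constant cancels from detailed
  balance.\<close>

lemma transitive_reversible_imp_symmetric:
  assumes X: "finite X" and irr: "irreducible_chain X P" and tr: "transitive_chain X P"
    and st: "stationary_distribution X P \<pi>" and rev: "reversible_chain X P \<pi>"
    and ab: "a \<in> X" "b \<in> X"
  shows "P a b = P b a"
proof -
  have sum: "(\<Sum>a\<in>X. \<pi> a) = 1"
    using st by (simp add: stationary_distribution_def)
  have const: "\<pi> v = \<pi> u" if uv: "u \<in> X" "v \<in> X" for u v
  proof -
    obtain \<phi> where \<phi>: "bij_betw \<phi> X X" "\<phi> u = v" "\<forall>a\<in>X. \<forall>b\<in>X. P (\<phi> a) (\<phi> b) = P a b"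
      using tr uv unfolding transitive_chain_def by blast
    have "reversible_chain X P (\<pi> \<circ> \<phi>)"
      unfolding reversible_chain_def
    proof (intro ballI)
      fix a b assume ab: "a \<in> X" "b \<in> X"
      then have "\<phi> a \<in> X" "\<phi> b \<in> X" using \<phi>(1) by (auto dest: bij_betwE)
      with rev have "\<pi> (\<phi> a) * P (\<phi> a) (\<phi> b) = \<pi> (\<phi> b) * P (\<phi> b) (\<phi> a)"
        by (simp add: reversible_chain_def)
      then show "(\<pi> \<circ> \<phi>) a * P a b = (\<pi> \<circ> \<phi>) b * P b a"
        using \<phi>(3) ab by simp
    qed
    moreover have "(\<Sum>a\<in>X. (\<pi> \<circ> \<phi>) a) = 1"
      using sum sum.reindex_bij_betw[OF \<phi>(1), of \<pi>] by simp
    ultimately have "(\<pi> \<circ> \<phi>) u = \<pi> u"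
      using reversible_distribution_unique[OF X irr _ rev _ sum uv(1)] by blast
    then show ?thesis using \<phi>(2) by simp
  qed
  have "\<pi> a \<noteq> 0"
  proof
    assume "\<pi> a = 0"
    then have "\<pi> v = 0" if "v \<in> X" for v using const[OF ab(1) that] by simp
    then have "(\<Sum>a\<in>X. \<pi> a) = 0" by simp
    then show False using sum by simp
  qed
  moreover have "\<pi> a * P a b = \<pi> b * P b a"
    using rev ab by (simp add: reversible_chain_def)
  ultimately show ?thesis using const[OF ab] by simp
qed

text \<open>Automorphisms preserve I - P, so its powers have constant diagonal; this trades the
  entry at the starting state for a trace.\<close>

lemma card_kernel_power_diag:
  assumes "transitive_chain X P" and x: "x \<in> X"
  shows "real (card X) * kernel_power X (\<lambda>a b. id_kernel a b - P a b) k x x =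
    (\<Sum>a\<in>X. kernel_power X (\<lambda>a b. id_kernel a b - P a b) k a a)"
proof -
  have "kernel_power X (\<lambda>a b. id_kernel a b - P a b) k a a =
      kernel_power X (\<lambda>a b. id_kernel a b - P a b) k x x" if a: "a \<in> X" for a
  proof -
    obtain \<phi> where \<phi>: "bij_betw \<phi> X X" "\<phi> x = a" "\<forall>a\<in>X. \<forall>b\<in>X. P (\<phi> a) (\<phi> b) = P a b"
      using assms a unfolding transitive_chain_def by blast
    have "\<forall>a\<in>X. \<forall>b\<in>X. id_kernel (\<phi> a) (\<phi> b) - P (\<phi> a) (\<phi> b) = id_kernel a b - P a b"
      using \<phi> bij_betw_imp_inj_on[OF \<phi>(1)] by (auto simp: id_kernel_def inj_on_def)
    from kernel_power_bij[of \<phi> X "\<lambda>a b. id_kernel a b - P a b", OF \<phi>(1) this x x] show ?thesis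
      using \<phi>(2) by simp
  qed
  then have "(\<Sum>a\<in>X. kernel_power X (\<lambda>a b. id_kernel a b - P a b) k a a) =
      (\<Sum>a\<in>X. kernel_power X (\<lambda>a b. id_kernel a b - P a b) k x x)"
    by (rule sum.cong[OF refl])
  then show ?thesis by simp
qed

section \<open>Lipschitz bounds in time\<close>

lemma heat_kernel_difference:
  assumes X: "finite X" "x \<in> X" and sym: "\<forall>a\<in>X. \<forall>b\<in>X. P a b = P b a" and "r < s"
  obtains \<xi> where "r < \<xi>" "\<xi> < s"
    "(\<Sum>y\<in>X. \<bar>heat_kernel X P s x y - heat_kernel X P r x y\<bar>) \<le> (s - r) *
      sqrt (card X * (\<Sum>k. (- 2 * \<xi>) ^ k / fact k * kernel_power X (\<lambda>a b. id_kernel a b - P a b) (k + 2) x x))"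
proof -
  define M where "M = (\<lambda>a b. id_kernel a b - P a b)"
  define D where "D = (\<lambda>s y. \<Sum>k. (- s) ^ k / fact k * kernel_power X M (Suc k) x y)"
  \<comment> \<open>Freezing the signs of the increments makes the sum of absolute values the
    increment of one smooth scalar function, so the mean value theorem yields a single \<xi> for all
    \<open>y\<close>.\<close>
  define \<sigma> where "\<sigma> = (\<lambda>y. sgn (heat_kernel X P s x y - heat_kernel X P r x y))"
  have deriv: "((\<lambda>s. \<Sum>y\<in>X. \<sigma> y * heat_kernel X P s x y) has_real_derivative (\<Sum>y\<in>X. \<sigma> y * (- D u y))) (at u)" for u
  proof (intro DERIV_sum DERIV_cmult)
    fix y assume y: "y \<in> X"
    have "((\<lambda>s. kernel_exp X M (- s) x y) has_real_derivative D u y * (- 1)) (at u)"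
      unfolding D_def
      by (rule DERIV_chain2[OF has_real_derivative_kernel_exp[OF X y]]) (auto intro!: derivative_eq_intros)
    then show "((\<lambda>s. heat_kernel X P s x y) has_real_derivative - D u y) (at u)"
      unfolding heat_kernel_def M_def by simp
  qed
  obtain \<xi> where \<xi>: "r < \<xi>" "\<xi> < s"
    "(\<Sum>y\<in>X. \<sigma> y * heat_kernel X P s x y) - (\<Sum>y\<in>X. \<sigma> y * heat_kernel X P r x y) =
      (s - r) * (\<Sum>y\<in>X. \<sigma> y * (- D \<xi> y))"
    using MVT2[OF \<open>r < s\<close> deriv] by blast
  have "(\<Sum>y\<in>X. \<bar>heat_kernel X P s x y - heat_kernel X P r x y\<bar>) =
      (\<Sum>y\<in>X. \<sigma> y * heat_kernel X P s x y) - (\<Sum>y\<in>X. \<sigma> y * heat_kernel X P r x y)"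
    unfolding sum_subtractf[symmetric] right_diff_distrib[symmetric]
    by (simp add: \<sigma>_def abs_sgn mult.commute)
  also have "\<dots> = (s - r) * (\<Sum>y\<in>X. \<sigma> y * (- D \<xi> y))" by fact
  also have "\<dots> \<le> (s - r) * (\<Sum>y\<in>X. \<bar>D \<xi> y\<bar>)"
  proof (intro mult_left_mono sum_mono)
    fix y show "\<sigma> y * (- D \<xi> y) \<le> \<bar>D \<xi> y\<bar>"
      by (auto simp: \<sigma>_def sgn_if)
  qed (use \<open>r < s\<close> in simp)
  \<comment> \<open>Cauchy-Schwarz against the constant function 1 produces the factor
    \<open>card X\<close>, which later cancels the \<open>1 / card X\<close> of the averaged
    trace.\<close>
  also have "(\<Sum>y\<in>X. \<bar>D \<xi> y\<bar>) \<le> sqrt (card X * (\<Sum>y\<in>X. (D \<xi> y)\<^sup>2))"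
    using Cauchy_Schwarz_ineq_sum[of "\<lambda>_. 1" "\<lambda>y. \<bar>D \<xi> y\<bar>" X] by (intro real_le_rsqrt) simp
  also have "(\<Sum>y\<in>X. (D \<xi> y)\<^sup>2) = (\<Sum>k. (- 2 * \<xi>) ^ k / fact k * kernel_power X M (k + 2) x x)"
  proof -
    have "\<forall>a\<in>X. \<forall>b\<in>X. M a b = M b a"
      using sym by (simp add: M_def id_kernel_def)
    from sums_unique[OF sum_kernel_exp_derivative_square[OF X this, of "- \<xi>"]]
    show ?thesis unfolding D_def by simp
  qed
  finally have "(\<Sum>y\<in>X. \<bar>heat_kernel X P s x y - heat_kernel X P r x y\<bar>) \<le> (s - r) *
      sqrt (card X * (\<Sum>k. (- 2 * \<xi>) ^ k / fact k * kernel_power X M (k + 2) x x))"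
    using \<open>r < s\<close> by (simp del: kernel_power.simps)
  from that[OF \<xi>(1,2) this[unfolded M_def]] show ?thesis .
qed

text \<open>Each coefficient of the series becomes a power sum of the \<open>1 - \<beta> i\<close>.
  Exchanging the finite sum with the series leaves one exponential series per eigenvalue, with two
  powers of \<open>1 - \<beta> i\<close> left over as prefactor.\<close>

lemma sums_kernel_power_eigenvalues:
  assumes X: "finite X" "x \<in> X" and tr: "transitive_chain X P" and ev: "ordered_eigenvalues X P \<beta>"
  shows "card X * (\<Sum>k. s ^ k / fact k * kernel_power X (\<lambda>a b. id_kernel a b - P a b) (k + 2) x x) =
    (\<Sum>i=1..card X. (1 - \<beta> i)\<^sup>2 * exp (s * (1 - \<beta> i)))"
proof -
  let ?M = "\<lambda>a b. id_kernel a b - P a b"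
  have "(\<lambda>k. card X * (s ^ k / fact k * kernel_power X ?M (k + 2) x x)) sums
      (card X * (\<Sum>k. s ^ k / fact k * kernel_power X ?M (k + 2) x x))"
    by (intro sums_mult summable_sums summable_norm_cancel[OF summable_kernel_power] X)
  moreover have "card X * (s ^ k / fact k * kernel_power X ?M (k + 2) x x) =
      (\<Sum>i=1..card X. (1 - \<beta> i)\<^sup>2 * ((s * (1 - \<beta> i)) ^ k /\<^sub>R fact k))" for k
  proof -
    have "card X * (s ^ k / fact k * kernel_power X ?M (k + 2) x x) =
        s ^ k / fact k * (card X * kernel_power X ?M (k + 2) x x)"
      by (rule mult.left_commute)
    also have "\<dots> = s ^ k / fact k * (\<Sum>i=1..card X. (1 - \<beta> i) ^ (k + 2))"
      unfolding card_kernel_power_diag[OF tr X(2)] sum_kernel_power_diag[OF X(1) ev] ..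
    also have "\<dots> = (\<Sum>i=1..card X. (1 - \<beta> i)\<^sup>2 * ((s * (1 - \<beta> i)) ^ k /\<^sub>R fact k))"
      unfolding sum_distrib_left
      by (rule sum.cong) (auto simp: power_add power_mult_distrib divide_inverse power2_eq_square)
    finally show ?thesis .
  qed
  moreover have "(\<lambda>k. \<Sum>i=1..card X. (1 - \<beta> i)\<^sup>2 * ((s * (1 - \<beta> i)) ^ k /\<^sub>R fact k)) sums
      (\<Sum>i=1..card X. (1 - \<beta> i)\<^sup>2 * exp (s * (1 - \<beta> i)))"
    by (intro sums_sum sums_mult exp_converges)
  ultimately show ?thesis
    by (simp only: sums_unique2)
qed

text \<open>The mean value point \<xi> is unknown, but each exponential decreases in time, so the
  spectral sum may be evaluated at any earlier time \<open>q\<close>. This gives one constant for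
  all later intervals.\<close>

lemma tv_distance_heat_kernel_lipschitz:
  assumes X: "finite X" "x \<in> X" and sym: "\<forall>a\<in>X. \<forall>b\<in>X. P a b = P b a"
    and tr: "transitive_chain X P" and ev: "ordered_eigenvalues X P \<beta>"
    and \<beta>: "\<beta> 1 = 1" "\<And>i. i \<in> {2..card X} \<Longrightarrow> \<beta> i < 1" and "q \<le> r" "r < s"
  shows "\<bar>tv_distance X (heat_kernel X P s x) \<pi> - tv_distance X (heat_kernel X P r x) \<pi>\<bar> \<le>
    (s - r) / 2 * sqrt (\<Sum>i=2..card X. (1 - \<beta> i)\<^sup>2 * exp (- 2 * q * (1 - \<beta> i)))"
proof -
  let ?h = "heat_kernel X P"
  obtain \<xi> where \<xi>: "r < \<xi>" and le: "(\<Sum>y\<in>X. \<bar>?h s x y - ?h r x y\<bar>) \<le>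
      (s - r) * sqrt (\<Sum>i=1..card X. (1 - \<beta> i)\<^sup>2 * exp (- 2 * \<xi> * (1 - \<beta> i)))"
    using heat_kernel_difference[OF X sym \<open>r < s\<close>]
    unfolding sums_kernel_power_eigenvalues[OF X tr ev] by blast
  have "0 < card X"
    using X card_gt_0_iff by blast
  then have "(\<Sum>i=1..card X. (1 - \<beta> i)\<^sup>2 * exp (- 2 * \<xi> * (1 - \<beta> i))) =
      (\<Sum>i=2..card X. (1 - \<beta> i)\<^sup>2 * exp (- 2 * \<xi> * (1 - \<beta> i)))"
    \<comment> \<open>The summand \<open>i = 1\<close> vanishes because of its factor
      \<open>1 - \<beta> 1\<close>.\<close>
    using \<beta>(1) by (subst sum.atLeast_Suc_atMost) (simp_all add: numeral_2_eq_2)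
  also have "\<dots> \<le> (\<Sum>i=2..card X. (1 - \<beta> i)\<^sup>2 * exp (- 2 * q * (1 - \<beta> i)))"
  proof (intro sum_mono mult_left_mono)
    fix i assume "i \<in> {2..card X}"
    then have "0 \<le> (\<xi> - q) * (1 - \<beta> i)"
      using \<beta>(2)[of i] \<xi> \<open>q \<le> r\<close> by simp
    then show "exp (- 2 * \<xi> * (1 - \<beta> i)) \<le> exp (- 2 * q * (1 - \<beta> i))"
      by (simp add: algebra_simps)
  qed simp
  finally have "(s - r) * sqrt (\<Sum>i=1..card X. (1 - \<beta> i)\<^sup>2 * exp (- 2 * \<xi> * (1 - \<beta> i))) \<le>
      (s - r) * sqrt (\<Sum>i=2..card X. (1 - \<beta> i)\<^sup>2 * exp (- 2 * q * (1 - \<beta> i)))"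
    using \<open>r < s\<close> by (intro mult_left_mono real_sqrt_le_mono) auto
  moreover have "\<bar>(\<Sum>y\<in>X. \<bar>?h s x y - \<pi> y\<bar>) - (\<Sum>y\<in>X. \<bar>?h r x y - \<pi> y\<bar>)\<bar> \<le>
      (\<Sum>y\<in>X. \<bar>?h s x y - ?h r x y\<bar>)"
    unfolding sum_subtractf[symmetric]
    by (rule order_trans[OF sum_abs]) (rule sum_mono, arith)
  ultimately have "\<bar>(\<Sum>y\<in>X. \<bar>?h s x y - \<pi> y\<bar>) - (\<Sum>y\<in>X. \<bar>?h r x y - \<pi> y\<bar>)\<bar> \<le>
      (s - r) * sqrt (\<Sum>i=2..card X. (1 - \<beta> i)\<^sup>2 * exp (- 2 * q * (1 - \<beta> i)))"
    using le by linarith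
  then show ?thesis
    unfolding tv_distance_def right_diff_distrib[symmetric] abs_mult by simp
qed

section \<open>Passage to the limit profile\<close>

theorem theorem4:
  fixes X :: "nat \<Rightarrow> 'a set"
    and P :: "nat \<Rightarrow> 'a \<Rightarrow> 'a \<Rightarrow> real"
    and \<pi> :: "nat \<Rightarrow> 'a \<Rightarrow> real"
    and \<beta> :: "nat \<Rightarrow> nat \<Rightarrow> real"
    and x :: "nat \<Rightarrow> 'a"
    and t w :: "nat \<Rightarrow> real"
    and g \<Phi> :: "real \<Rightarrow> real"
    and d :: "nat \<Rightarrow> real \<Rightarrow> real"
  defines "d \<equiv> (\<lambda>n s. tv_distance (X n) (heat_kernel (X n) (P n) s (x n)) (\<pi> n))"
  assumes "\<And>n. finite (X n)"
    and "\<And>n. x n \<in> X n"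
    and "\<And>n. transition_matrix (X n) (P n)"
    and "\<And>n. irreducible_chain (X n) (P n)"
    and "\<And>n. aperiodic_chain (X n) (P n)"
    and "\<And>n. transitive_chain (X n) (P n)"
    and "\<And>n. stationary_distribution (X n) (P n) (\<pi> n)"
    and "\<And>n. reversible_chain (X n) (P n) (\<pi> n)"
    and "\<And>n. ordered_eigenvalues (X n) (P n) (\<beta> n)"
    and "\<And>n. \<beta> n 1 = 1"
    and "\<And>n i. i \<in> {2..card (X n)} \<Longrightarrow> \<beta> n i < 1"
    and "\<And>n i. i \<in> {1..card (X n)} \<Longrightarrow> - 1 < \<beta> n i"
    and "has_cutoff d t w"
    and "continuous_on UNIV g \<or> bounded (range g)"
    and "\<And>c. limsup (\<lambda>n. ereal ((w n)\<^sup>2 *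
           (\<Sum>i=2..card (X n). (1 - \<beta> n i)\<^sup>2 * exp (- 2 * (t n + c * w n) * (1 - \<beta> n i)))))
         \<le> ereal (g c)"
    and "\<And>c. (\<lambda>n. d n (t n + c * w n)) \<longlonglongrightarrow> \<Phi> c"
  shows "(\<forall>c. \<Phi> c \<in> {0..1}) \<and> continuous_on UNIV \<Phi>"
proof -
  have nonneg: "\<forall>\<^sub>F n in sequentially. 0 \<le> t n + c * w n" for c
  proof -
    have tw: "\<And>n. t n > 0" "\<And>n. w n > 0" "w \<in> o(t)"
      using \<open>has_cutoff d t w\<close> by (auto simp: has_cutoff_def)
    \<comment> \<open>With this constant \<open>w \<in> o(t)\<close> gives
      \<open>(\<bar>c\<bar> + 1) * w n \<le> t n\<close> eventually, which dominates a negative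
      \<open>c * w n\<close>.\<close>
    have "0 < inverse (\<bar>c\<bar> + 1)" by simp
    from landau_o.smallD[OF tw(3) this] show ?thesis
    proof eventually_elim
      case (elim n)
      then have "(\<bar>c\<bar> + 1) * w n \<le> t n"
        using tw(1,2)[of n] by (simp add: field_simps)
      moreover have "- (c * w n) \<le> \<bar>c\<bar> * w n"
        using tw(2)[of n] by (simp add: abs_if)
      ultimately show ?case
        using tw(2)[of n] by (simp add: distrib_right)
    qed
  qed
  have w: "w n > 0" for n
    using \<open>has_cutoff d t w\<close> by (simp add: has_cutoff_def)
  have "0 \<le> \<Phi> c" for c
    by (rule tendsto_lowerbound[OF assms(17)])
      (auto simp: d_def tv_distance_def intro!: always_eventually sum_nonneg)
  moreover have "\<Phi> c \<le> 1" for c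
  proof (rule tendsto_upperbound[OF assms(17)])
    show "\<forall>\<^sub>F n in sequentially. d n (t n + c * w n) \<le> 1"
      using nonneg[of c]
    proof eventually_elim
      case (elim n)
      then show ?case
        unfolding d_def using assms by (intro tv_distance_heat_kernel_le_1) auto
    qed
  qed simp
  moreover have lip: "\<bar>\<Phi> v - \<Phi> u\<bar> \<le> (v - u) / 2 * sqrt (g a + 1)" if uv: "a \<le> u" "u < v" for a u v
  proof (rule tendsto_upperbound)
    show "(\<lambda>n. \<bar>d n (t n + v * w n) - d n (t n + u * w n)\<bar>) \<longlonglongrightarrow> \<bar>\<Phi> v - \<Phi> u\<bar>"
      by (intro tendsto_rabs tendsto_diff assms(17))
    let ?S = "\<lambda>n. \<Sum>i=2..card (X n). (1 - \<beta> n i)\<^sup>2 * exp (- 2 * (t n + a * w n) * (1 - \<beta> n i))"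
    \<comment> \<open>The added 1 makes the bound strict, so that it holds for all large
      \<open>n\<close> and not just in the limit.\<close>
    have "limsup (\<lambda>n. ereal ((w n)\<^sup>2 * ?S n)) < ereal (g a + 1)"
      using assms(16)[of a] by (rule le_less_trans) simp
    then have "\<forall>\<^sub>F n in sequentially. ereal ((w n)\<^sup>2 * ?S n) < ereal (g a + 1)"
      by (rule Limsup_lessD)
    then show "\<forall>\<^sub>F n in sequentially. \<bar>d n (t n + v * w n) - d n (t n + u * w n)\<bar> \<le> (v - u) / 2 * sqrt (g a + 1)"
    proof eventually_elim
      case (elim n)
      have "\<forall>a\<in>X n. \<forall>b\<in>X n. P n a b = P n b a"
        by (intro ballI transitive_reversible_imp_symmetric[of "X n" "P n" "\<pi> n"] assms)
      then have "\<bar>d n (t n + v * w n) - d n (t n + u * w n)\<bar> \<le>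
          ((t n + v * w n) - (t n + u * w n)) / 2 * sqrt (?S n)"
        unfolding d_def using w[of n] uv
        by (intro tv_distance_heat_kernel_lipschitz assms) auto
      \<comment> \<open>The time gap is \<open>(v - u) * w n\<close>; moving \<open>w n\<close>
        under the root produces the factor \<open>(w n)\<^sup>2\<close> of the hypothesis.\<close>
      also have "\<dots> = (v - u) / 2 * sqrt ((w n)\<^sup>2 * ?S n)"
        using w[of n] by (simp add: real_sqrt_mult left_diff_distrib)
      also have "\<dots> \<le> (v - u) / 2 * sqrt (g a + 1)"
        using elim uv by (intro mult_left_mono real_sqrt_le_mono) auto
      finally show ?case .
    qed
  qed simp
  moreover have "continuous (at c) \<Phi>" for c
  proof -
    \<comment> \<open>The base point \<open>c - 1\<close> leaves an open half-line around
      \<open>c\<close>. Since \<open>sqrt\<close> of a negative real is negative here, the absolute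
      value of \<open>?L\<close> serves as the Lipschitz constant.\<close>
    let ?L = "sqrt (g (c - 1) + 1) / 2"
    have *: "\<bar>\<Phi> v - \<Phi> u\<bar> \<le> \<bar>?L\<bar> * \<bar>v - u\<bar>" if "c - 1 < u" "u < v" for u v
    proof -
      have "\<bar>\<Phi> v - \<Phi> u\<bar> \<le> ?L * (v - u)"
        using lip[of "c - 1" u v] that by (simp add: mult.commute)
      also have "\<dots> \<le> \<bar>?L\<bar> * \<bar>v - u\<bar>"
        using that by (intro mult_mono) auto
      finally show ?thesis .
    qed
    have "\<bar>?L\<bar>-lipschitz_on {c - 1<..} \<Phi>"
    proof (rule lipschitz_onI)
      fix u v assume "u \<in> {c - 1<..}" "v \<in> {c - 1<..}"
      then show "dist (\<Phi> u) (\<Phi> v) \<le> \<bar>?L\<bar> * dist u v"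
        using *[of u v] *[of v u]
        by (cases u v rule: linorder_cases) (simp_all add: dist_real_def abs_minus_commute)
    qed simp
    then have "continuous_on {c - 1<..} \<Phi>"
      by (rule lipschitz_on_continuous_on)
    then show ?thesis
      by (simp add: continuous_on_eq_continuous_at)
  qed
  ultimately show ?thesis
    by (simp add: continuous_at_imp_continuous_on)
qed

end
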